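(* Let $C\subset\mathbb{R}^n$ be a nonempty closed convex set, let $F:\mathbb{R}^n\to\mathbb{R}^n$ be continuous and monotone, and let $f:\mathbb{R}^n\to\mathbb{R}$ be a continuous convex function. Let $\bar x$ be a solution of the variational inequality $VI(F,C)$. Assume that the set $$\operatorname{cone}\Big(\bigcup_{y\in C}\{F(y)\}\times[\langle F(y),y\rangle,+\infty)\Big)+\operatorname{epi}\delta_C^*$$ is closed in $\mathbb{R}^{n+1}$. Then $\bar x$ is a solution of (SMPEC) if and only if there exist $k\in\mathbb{N}$, $\lambda_1,\dots,\lambda_k>0$ and $y_1,\dots,y_k\in C$ such that $$0\in\partial f(\bar x)+\sum_{i=1}^k\lambda_iF(y_i)+N_C(\bar x)$$ and $$\langle F(y_i),\bar x-y_i\rangle=0\quad\text{for all } i=1,\dots,k.$$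
   Context: $F$ is monotone if $\langle F(y)-F(x),y-x\rangle\ge 0$ for all $x,y\in\mathbb{R}^n$. The variational inequality $VI(F,C)$ is: find $x\in C$ such that $\langle F(x),y-x\rangle\ge0$ for all $y\in C$; its solution set is $S=\operatorname{sol}(VI(F,C))$, which is assumed nonempty. The problem (SMPEC) is: minimize $f(x)$ subject to $x\in S$; "solution of (SMPEC)" means a global minimizer of $f$ over $S$. $\partial f(x)=\{v: f(y)\ge f(x)+\langle v,y-x\rangle\ \forall y\in\mathbb{R}^n\}$ is the convex subdifferential, $N_C(\bar x)=\{w:\langle w,x-\bar x\rangle\le0\ \forall x\in C\}$ is the normal cone at $\bar x\in C$. $\delta_C$ is the indicator function of $C$ ($0$ on $C$, $+\infty$ elsewhere), $\delta_C^*(v)=\sup_{x\in C}\langle v,x\rangle$ is its conjugate, and $\operatorname{epi}\phi=\{(x,r)\in\mathbb{R}^n\times\mathbb{R}: \phi(x)\le r\}$. For a set $D$, $\operatorname{cone}D$ is the convex cone generated by $D\cup\{0\}$, i.e. the set of all finite nonnegative combinations of elements of $D$. *)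

theory Defs
  imports "HOL-Analysis.Analysis"
begin

definition monotone_op :: "('a::real_inner \<Rightarrow> 'a) \<Rightarrow> bool" where
  "monotone_op F \<longleftrightarrow> (\<forall>x y. (F y - F x) \<bullet> (y - x) \<ge> 0)"

definition VI_sol :: "('a::real_inner \<Rightarrow> 'a) \<Rightarrow> 'a set \<Rightarrow> 'a set" where
  "VI_sol F C = {x \<in> C. \<forall>y\<in>C. F x \<bullet> (y - x) \<ge> 0}"

definition SMPEC_solution ::
  "('a::real_inner \<Rightarrow> real) \<Rightarrow> ('a \<Rightarrow> 'a) \<Rightarrow> 'a set \<Rightarrow> 'a \<Rightarrow> bool" where
  "SMPEC_solution f F C x \<longleftrightarrow> x \<in> VI_sol F C \<and> (\<forall>z\<in>VI_sol F C. f x \<le> f z)"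

definition subdifferential :: "('a::real_inner \<Rightarrow> real) \<Rightarrow> 'a \<Rightarrow> 'a set" where
  "subdifferential f x = {v. \<forall>y. f y \<ge> f x + v \<bullet> (y - x)}"

text \<open>The normal cone is only meaningful at points of \<open>C\<close>: elsewhere this is not the usual convention (empty set).\<close>

definition normal_cone :: "'a::real_inner set \<Rightarrow> 'a \<Rightarrow> 'a set" where
  "normal_cone C x = {w. \<forall>z\<in>C. w \<bullet> (z - x) \<le> 0}"

definition delta :: "'a set \<Rightarrow> 'a \<Rightarrow> ereal" where
  "delta C x = (if x \<in> C then 0 else \<infinity>)"

definition conjugate :: "('a::real_inner \<Rightarrow> ereal) \<Rightarrow> 'a \<Rightarrow> ereal" where
  "conjugate \<phi> v = (SUP x. ereal (v \<bullet> x) - \<phi> x)"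

lemma conjugate_delta: "conjugate (delta C) v = (SUP x\<in>C. ereal (v \<bullet> x))"
proof (rule antisym)
  show "conjugate (delta C) v \<le> (SUP x\<in>C. ereal (v \<bullet> x))"
    unfolding conjugate_def delta_def by (rule SUP_least) (auto intro: SUP_upper)
next
  have "ereal (v \<bullet> x) \<le> conjugate (delta C) v" if "x \<in> C" for x
    unfolding conjugate_def using that
    by (intro SUP_upper2[of x]) (auto simp: delta_def)
  then show "(SUP x\<in>C. ereal (v \<bullet> x)) \<le> conjugate (delta C) v"
    by (rule SUP_least)
qed

text \<open>The library's \<open>epigraph\<close> only covers real-valued functions.\<close>

definition epi :: "('a \<Rightarrow> ereal) \<Rightarrow> ('a \<times> real) set" where
  "epi \<phi> = {(x, r). \<phi> x \<le> ereal r}"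

end

theory Submission
  imports Defs
begin

text \<open>
  The solution set \<open>S\<close> of a continuous monotone variational inequality is, by Minty's lemma
  (\<open>VI_sol_eq_Minty\<close>), the intersection of \<open>C\<close> with the half-spaces
  \<open>F y \<bullet> x \<le> F y \<bullet> y\<close>, \<open>y \<in> C\<close>. The bilevel problem is therefore a convex program with infinitely
  many linear constraints, and the theorem is its multiplier rule.

  At a minimizer \<open>xbar\<close> some subgradient \<open>v\<close> of \<open>f\<close> satisfies \<open>v \<bullet> (z - xbar) \<ge> 0\<close> on \<open>S\<close>
  (\<open>convex_minimizer_subgradient\<close>), that is, \<open>- v \<bullet> z \<le> - v \<bullet> xbar\<close> is a consequence of the
  constraints defining \<open>S\<close>. The set whose closedness is assumed is the convex cone of all
  inequalities \<open>a \<bullet> x \<le> r\<close>, encoded as \<open>(a, r)\<close>, that are sums of finitely many nonnegative multiples of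
  constraints and of an inequality valid on \<open>C\<close>. When that cone is closed, Farkas' lemma
  (\<open>Farkas_closed_cone\<close>) says that it contains every consequence. Hence
  \<open>(- v, - v \<bullet> xbar)\<close> is such a sum. As the consequence holds with equality at \<open>xbar\<close> while
  every summand is valid there, every summand is also tight at \<open>xbar\<close>: this is complementarity
  for the points \<open>y i\<close>, and membership in the normal cone for the part coming from \<open>C\<close>.

  Conversely, adding up the subgradient inequality, the constraints at the \<open>y i\<close> and the normal
  cone inequality gives \<open>f xbar \<le> f z\<close> on \<open>S\<close>; this direction is weak duality.
\<close>

section \<open>Solutions of a monotone variational inequality\<close>

text \<open>One inclusion is monotonicity. For the other, the inequality at the points \<open>x + t (y - x)\<close>
  of \<open>C\<close> is divided by \<open>t > 0\<close>, and \<open>t\<close> tends to \<open>0\<close>.\<close>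

lemma VI_sol_eq_Minty:
  fixes F :: "'a::real_inner \<Rightarrow> 'a"
  assumes "convex C" "continuous_on UNIV F" "monotone_op F"
  shows "VI_sol F C = {x \<in> C. \<forall>y\<in>C. F y \<bullet> x \<le> F y \<bullet> y}"
proof (intro set_eqI iffI)
  fix x assume x: "x \<in> VI_sol F C"
  have "F y \<bullet> x \<le> F y \<bullet> y" if "y \<in> C" for y
  proof -
    have "(F y - F x) \<bullet> (y - x) \<ge> 0" "F x \<bullet> (y - x) \<ge> 0"
      using assms(3) x that by (auto simp: monotone_op_def VI_sol_def)
    then show ?thesis by (simp add: algebra_simps)
  qed
  then show "x \<in> {x \<in> C. \<forall>y\<in>C. F y \<bullet> x \<le> F y \<bullet> y}"
    using x by (auto simp: VI_sol_def)
next
  fix x assume "x \<in> {x \<in> C. \<forall>y\<in>C. F y \<bullet> x \<le> F y \<bullet> y}"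
  then have xC: "x \<in> C" and x: "\<And>y. y \<in> C \<Longrightarrow> F y \<bullet> x \<le> F y \<bullet> y" by auto
  have "F x \<bullet> (y - x) \<ge> 0" if y: "y \<in> C" for y
  proof -
    define t where "t n = inverse (real (Suc n))" for n
    have t: "0 < t n" "t n \<le> 1" for n by (auto simp: t_def field_simps)
    have t0: "t \<longlonglongrightarrow> 0"
      unfolding t_def by (rule LIMSEQ_inverse_real_of_nat)
    have "(\<lambda>n. x + t n *\<^sub>R (y - x)) \<longlonglongrightarrow> x + 0 *\<^sub>R (y - x)"
      by (intro tendsto_intros t0)
    moreover have "isCont F x"
      using assms(2) by (simp add: continuous_on_eq_continuous_at)
    ultimately have "(\<lambda>n. F (x + t n *\<^sub>R (y - x))) \<longlonglongrightarrow> F x"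
      by (intro isCont_tendsto_compose[of x F]) simp_all
    then have lim: "(\<lambda>n. F (x + t n *\<^sub>R (y - x)) \<bullet> (y - x)) \<longlonglongrightarrow> F x \<bullet> (y - x)"
      by (intro tendsto_intros)
    have "0 \<le> F (x + t n *\<^sub>R (y - x)) \<bullet> (y - x)" for n
    proof -
      have "x + t n *\<^sub>R (y - x) = (1 - t n) *\<^sub>R x + t n *\<^sub>R y"
        by (simp add: algebra_simps)
      then have "x + t n *\<^sub>R (y - x) \<in> C"
        using convexD_alt[OF assms(1) xC y] t[of n] by (simp add: less_imp_le)
      from x[OF this] have "0 \<le> t n * (F (x + t n *\<^sub>R (y - x)) \<bullet> (y - x))"
        by (simp add: inner_add_right)
      then show ?thesis using t(1)[of n] by (simp add: zero_le_mult_iff)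
    qed
    then show ?thesis by (intro LIMSEQ_le_const[OF lim]) auto
  qed
  then show "x \<in> VI_sol F C" using xC by (simp add: VI_sol_def)
qed

lemma convex_VI_sol:
  fixes F :: "'a::real_inner \<Rightarrow> 'a"
  assumes "convex C" "continuous_on UNIV F" "monotone_op F"
  shows "convex (VI_sol F C)"
proof -
  have "VI_sol F C = C \<inter> (\<Inter>y\<in>C. {x. F y \<bullet> x \<le> F y \<bullet> y})"
    using VI_sol_eq_Minty[OF assms] by auto
  then show ?thesis
    using assms(1) by (auto intro!: convex_Int convex_INT convex_halfspace_le)
qed

section \<open>First-order condition for a constrained convex minimum\<close>

text \<open>The epigraph of \<open>f\<close> does not meet \<open>S \<times> {..<f xbar}\<close>, and a hyperplane separating the two
  cannot be vertical because \<open>f\<close> is finite everywhere. Its slope is the required subgradient.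
  The lemma plays the part of the subdifferential sum rule for \<open>f\<close> and the indicator
  function of \<open>S\<close>.\<close>

lemma convex_minimizer_subgradient:
  fixes f :: "'a::euclidean_space \<Rightarrow> real"
  assumes f: "convex_on UNIV f" and S: "convex S" "xbar \<in> S"
    and min: "\<And>z. z \<in> S \<Longrightarrow> f xbar \<le> f z"
  obtains v where "v \<in> subdifferential f xbar" "- v \<in> normal_cone S xbar"
proof -
  let ?E = "epigraph UNIV f" and ?L = "S \<times> {..<f xbar}"
  have cv: "convex ?E" "convex ?L"
    using f S by (simp_all add: convex_epigraph convex_Times)
  have "(xbar, f xbar) \<in> ?E" "(xbar, f xbar - 1) \<in> ?L"
    using S by (simp_all add: mem_epigraph)
  then have ne: "?E \<noteq> {}" "?L \<noteq> {}" by blast+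
  have "\<not> (f z \<le> r \<and> r < f xbar)" if "z \<in> S" for z r
    using min[OF that] by linarith
  then have "?E \<inter> ?L = {}" by (auto simp: epigraph_def)
  from separating_hyperplane_sets[OF cv ne this]
  obtain p b where p: "p \<noteq> 0" "\<forall>x\<in>?E. p \<bullet> x \<le> b" "\<forall>x\<in>?L. b \<le> p \<bullet> x"
    by blast
  obtain a \<alpha> where ap: "p = (a, \<alpha>)" by (cases p)
  have E: "a \<bullet> x + \<alpha> * r \<le> b" if "f x \<le> r" for x r
    using p(2) that by (auto simp: ap epigraph_def)
  have L: "b \<le> a \<bullet> z + \<alpha> * r" if "z \<in> S" "r < f xbar" for z r
    using p(3) that by (auto simp: ap)
  have "\<alpha> \<le> 0"
    using E[of xbar "f xbar"] E[of xbar "f xbar + 1"] L[OF S(2), of "f xbar - 1"]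
    by (simp add: algebra_simps)
  moreover have "\<alpha> \<noteq> 0"
  proof
    assume \<alpha>: "\<alpha> = 0"
    have "a \<bullet> (xbar + a) \<le> a \<bullet> xbar"
      using E[of "xbar + a" "f (xbar + a)"] L[OF S(2), of "f xbar - 1"] \<alpha> by simp
    then have "a \<bullet> a \<le> 0" by (simp add: inner_add_right)
    then have "a = 0" by (metis inner_gt_zero_iff not_less)
    then show False using p(1) ap \<alpha> by (simp add: zero_prod_def)
  qed
  ultimately have neg: "\<alpha> < 0" by simp
  \<comment> \<open>Let the second component tend to \<open>f xbar\<close> from below; \<open>e / \<alpha>\<close> is negative.\<close>
  have L': "b \<le> a \<bullet> z + \<alpha> * f xbar" if "z \<in> S" for z
  proof (rule field_le_epsilon)
    fix e :: real assume "e > 0"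
    then show "b \<le> a \<bullet> z + \<alpha> * f xbar + e"
      using L[OF that, of "f xbar + e / \<alpha>"] neg by (simp add: divide_pos_neg algebra_simps)
  qed
  define v where "v = (1 / - \<alpha>) *\<^sub>R a"
  have a: "a = (- \<alpha>) *\<^sub>R v" using neg by (simp add: v_def)
  have "f xbar + v \<bullet> (y - xbar) \<le> f y" for y
  proof -
    have "(- \<alpha>) * (f xbar + v \<bullet> (y - xbar)) \<le> (- \<alpha>) * f y"
      using E[of y "f y"] L'[OF S(2)] by (simp add: a algebra_simps)
    then show ?thesis using neg by (simp add: mult_le_cancel_left)
  qed
  moreover have "0 \<le> v \<bullet> (z - xbar)" if "z \<in> S" for z
  proof -
    have "0 \<le> (- \<alpha>) * (v \<bullet> (z - xbar))"
      using E[of xbar "f xbar"] L'[OF that] by (simp add: a algebra_simps)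
    then show ?thesis using neg by (metis neg_0_less_iff_less zero_le_mult_iff not_less)
  qed
  ultimately show thesis
    by (intro that[of v]) (auto simp: subdifferential_def normal_cone_def)
qed

section \<open>Convex cones of linear inequalities\<close>

lemma closed_convex_cone_separation:
  fixes M :: "'a::euclidean_space set"
  assumes M: "convex_cone M" "closed M" and "q \<notin> M"
  obtains p where "\<And>m. m \<in> M \<Longrightarrow> 0 \<le> p \<bullet> m" "p \<bullet> q < 0"
proof -
  obtain p b where p: "p \<bullet> q < b" "\<And>m. m \<in> M \<Longrightarrow> b < p \<bullet> m"
    using separating_hyperplane_closed_point[of M q] assms by (auto simp: convex_cone_def)
  have b: "b < 0" using p(2)[OF convex_cone_contains_0[OF M(1)]] by simp
  have "0 \<le> p \<bullet> m" if m: "m \<in> M" for m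
  proof (rule ccontr)
    assume neg: "\<not> 0 \<le> p \<bullet> m"
    \<comment> \<open>The multiple of \<open>m\<close> on which the separating functional takes the value \<open>b\<close>.\<close>
    have "(b / (p \<bullet> m)) *\<^sub>R m \<in> M"
      using neg b by (intro convex_cone_scaleR[OF M(1) _ m]) (simp add: divide_nonpos_neg)
    from p(2)[OF this] show False using neg by simp
  qed
  with p(1) b show thesis by (intro that) auto
qed

text \<open>The finite nonnegative combinations that make up a convex hull are rearranged into a
  sequence, keeping only the strictly positive coefficients. The vector \<open>0\<close> is the empty
  combination \<open>k = 0\<close>.\<close>

lemma convex_cone_hull_positive_combination:
  fixes D :: "'a::real_vector set"
  assumes "x \<in> convex_cone hull (D \<union> {0})"
  obtains k :: nat and lam p where "\<forall>i\<in>{1..k}. 0 < lam i \<and> p i \<in> D"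
    and "x = (\<Sum>i=1..k. lam i *\<^sub>R p i)"
proof -
  obtain c z where c: "0 \<le> c" "z \<in> convex hull (D \<union> {0})" "x = c *\<^sub>R z"
    using assms by (subst (asm) convex_cone_hull_convex_hull_nonempty) auto
  then obtain T u where T: "finite T" "T \<subseteq> D \<union> {0}" "\<forall>t\<in>T. 0 \<le> u t"
    and z: "z = (\<Sum>t\<in>T. u t *\<^sub>R t)"
    unfolding convex_hull_explicit by blast
  define P where "P = {t\<in>T. 0 < c * u t \<and> t \<noteq> 0}"
  have "x = (\<Sum>t\<in>T. (c * u t) *\<^sub>R t)"
    by (simp add: c z scaleR_sum_right)
  also have "\<dots> = (\<Sum>t\<in>P. (c * u t) *\<^sub>R t)"
    using T c(1) by (intro sum.mono_neutral_right)
      (auto simp: P_def zero_less_mult_iff less_le)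
  finally have x: "x = (\<Sum>t\<in>P. (c * u t) *\<^sub>R t)" .
  have "finite P" using T(1) by (simp add: P_def)
  then obtain h where h: "bij_betw h {1..card P} P"
    using ex_bij_betw_nat_finite_1 by blast
  show thesis
  proof (rule that[of "card P" "\<lambda>i. c * u (h i)" h])
    show "\<forall>i\<in>{1..card P}. 0 < c * u (h i) \<and> h i \<in> D"
      using bij_betwE[OF h] T(2) by (auto simp: P_def)
    show "x = (\<Sum>i=1..card P. (c * u (h i)) *\<^sub>R h i)"
      using x sum.reindex_bij_betw[OF h, of "\<lambda>t. (c * u t) *\<^sub>R t"] by simp
  qed
qed

lemma mem_epi_support:
  "(w, s) \<in> epi (conjugate (delta C)) \<longleftrightarrow> (\<forall>z\<in>C. w \<bullet> z \<le> s)"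
  by (simp add: epi_def conjugate_delta SUP_le_iff)

lemma convex_cone_epi_support:
  fixes C :: "'a::real_inner set"
  shows "convex_cone (epi (conjugate (delta C)))"
  unfolding convex_cone_iff
  by (auto simp: mem_epi_support zero_prod_def inner_add_left intro!: add_mono mult_left_mono)

text \<open>A point outside \<open>C\<close> is cut off by a half-space containing \<open>C\<close>, and the pairs in the
  epigraph of the support function are exactly the half-spaces containing \<open>C\<close>.\<close>

lemma mem_closed_convex_by_inequalities:
  fixes C :: "'a::euclidean_space set"
  assumes "convex C" "closed C"
    and z: "\<And>w s. (w, s) \<in> epi (conjugate (delta C)) \<Longrightarrow> w \<bullet> z \<le> s"
  shows "z \<in> C"
proof (rule ccontr)
  assume "z \<notin> C"
  then obtain a b where a: "a \<bullet> z < b" "\<forall>x\<in>C. b < a \<bullet> x"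
    using separating_hyperplane_closed_point[OF assms(1,2)] by blast
  then have "(- a, - b) \<in> epi (conjugate (delta C))"
    by (auto simp: mem_epi_support less_imp_le)
  from z[OF this] a(1) show False by simp
qed

text \<open>A pair \<open>(a, r)\<close> outside the cone is separated from it by a functional \<open>(u, t)\<close>, and
  \<open>t \<ge> 0\<close> because \<open>(0, 1)\<close> lies in the cone. If
  \<open>t > 0\<close>, the point \<open>- u / t\<close> satisfies all inequalities in the cone but violates
  \<open>a \<bullet> x \<le> r\<close>. The case \<open>t = 0\<close> is avoided by adding to \<open>(u, t)\<close> the functional
  \<open>(- x0, 1)\<close>: it is nonnegative on the cone because \<open>x0\<close> is feasible, and it vanishes at
  \<open>(a, r)\<close> because \<open>r = a \<bullet> x0\<close>, so the sum still separates.\<close>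

lemma Farkas_closed_cone:
  fixes M :: "('a::euclidean_space \<times> real) set"
  assumes M: "convex_cone M" "closed M" and vert: "(0, 1) \<in> M"
    and x0: "\<And>w s. (w, s) \<in> M \<Longrightarrow> w \<bullet> x0 \<le> s"
    and cons: "\<And>z. (\<And>w s. (w, s) \<in> M \<Longrightarrow> w \<bullet> z \<le> s) \<Longrightarrow> a \<bullet> z \<le> a \<bullet> x0"
  shows "(a, a \<bullet> x0) \<in> M"
proof (rule ccontr)
  assume "(a, a \<bullet> x0) \<notin> M"
  then obtain p where p: "\<And>m. m \<in> M \<Longrightarrow> 0 \<le> p \<bullet> m" "p \<bullet> (a, a \<bullet> x0) < 0"
    using closed_convex_cone_separation[OF M] by blast
  obtain u t where ut: "p = (u, t)" by (cases p)
  have t: "0 \<le> t" using p(1)[OF vert] by (simp add: ut)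
  define z where "z = (1 / (t + 1)) *\<^sub>R (x0 - u)"
  have z: "(t + 1) * (w \<bullet> z) = w \<bullet> x0 - u \<bullet> w" for w
    using t by (simp add: z_def inner_diff_right inner_commute)
  have "w \<bullet> z \<le> s" if "(w, s) \<in> M" for w s
  proof -
    have "(t + 1) * (w \<bullet> z) \<le> (t + 1) * s"
      using p(1)[OF that] x0[OF that] unfolding z by (simp add: ut algebra_simps)
    then show ?thesis using t by (simp add: mult_le_cancel_left)
  qed
  from cons[OF this] have "(t + 1) * (a \<bullet> z) \<le> (t + 1) * (a \<bullet> x0)"
    using t by (intro mult_left_mono) auto
  then show False using p(2) unfolding z by (simp add: ut algebra_simps)
qed

section \<open>The multiplier rule\<close>

theorem theorem3p1:
  fixes C :: "(real ^ 'n) set"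
    and F :: "real ^ 'n \<Rightarrow> real ^ 'n"
    and f :: "real ^ 'n \<Rightarrow> real"
    and xbar :: "real ^ 'n"
  assumes "C \<noteq> {}" and "closed C" and "convex C"
    and "continuous_on UNIV F" and "monotone_op F"
    and "continuous_on UNIV f" and "convex_on UNIV f"
    and "xbar \<in> VI_sol F C"
    and "closed (convex_cone hull ((\<Union>y\<in>C. {F y} \<times> {F y \<bullet> y..}) \<union> {0})
                 + epi (conjugate (delta C)))"
  shows "SMPEC_solution f F C xbar \<longleftrightarrow>
    (\<exists>(k::nat) (lam :: nat \<Rightarrow> real) (y :: nat \<Rightarrow> real ^ 'n).
       (\<forall>i\<in>{1..k}. lam i > 0 \<and> y i \<in> C) \<and>
       0 \<in> subdifferential f xbar + {\<Sum>i=1..k. lam i *\<^sub>R F (y i)} + normal_cone C xbar \<and>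
       (\<forall>i\<in>{1..k}. F (y i) \<bullet> (xbar - y i) = 0))"
proof
  let ?D = "\<Union>y\<in>C. {F y} \<times> {F y \<bullet> y..}"
  let ?K = "convex_cone hull (?D \<union> {0})" and ?E = "epi (conjugate (delta C))"
  note Minty = VI_sol_eq_Minty[OF assms(3,4,5)]
  have xbar: "xbar \<in> C" "\<And>y. y \<in> C \<Longrightarrow> F y \<bullet> xbar \<le> F y \<bullet> y"
    using assms(8) unfolding Minty by auto
  assume "SMPEC_solution f F C xbar"
  then have min: "f xbar \<le> f z" if "z \<in> VI_sol F C" for z
    using that by (auto simp: SMPEC_solution_def)
  obtain v where v: "v \<in> subdifferential f xbar" "- v \<in> normal_cone (VI_sol F C) xbar"
    using convex_minimizer_subgradient[OF assms(7) convex_VI_sol[OF assms(3,4,5)] assms(8) min]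
    by blast
  have K: "d \<in> ?K" if "d \<in> ?D" for d using that by (intro hull_inc) blast
  have KE: "d \<in> ?K + ?E" if "d \<in> ?K \<or> d \<in> ?E" for d
    using that set_plus_intro[of d ?K 0 ?E] set_plus_intro[of 0 ?K d ?E]
      convex_cone_contains_0[OF convex_cone_epi_support] convex_cone_hull_contains_0
    by auto
  \<comment> \<open>It suffices to check the generators: by Minty's lemma the constraints hold at \<open>xbar\<close>.\<close>
  have valid: "w \<bullet> xbar \<le> s" if ws: "(w, s) \<in> ?K + ?E" for w s
  proof -
    have "(xbar, -1) \<bullet> d \<le> 0" if "d \<in> ?D \<union> {0}" for d
      using that by (auto simp: inner_commute[of xbar] intro: order_trans[OF xbar(2)])
    then have K_valid: "?K \<subseteq> {d. (xbar, -1) \<bullet> d \<le> 0}"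
      by (intro hull_minimal convex_cone_halfspace_le) blast
    obtain d e where de: "d \<in> ?K" "e \<in> ?E" "(w, s) = d + e"
      using ws unfolding set_plus_def by blast
    have "(xbar, -1) \<bullet> e \<le> 0"
      using de(2) xbar(1) by (cases e) (simp add: mem_epi_support inner_commute)
    then have "(xbar, -1) \<bullet> (w, s) \<le> 0"
      using de(1) K_valid unfolding de(3) by (auto simp: inner_add_right)
    then show ?thesis by (simp add: inner_commute)
  qed
  have "convex_cone (?K + ?E)"
    using convex_cone_sums[OF convex_cone_convex_cone_hull[of "?D \<union> {0}"]
        convex_cone_epi_support[of C]]
    by (rule back_subst[of convex_cone]) (unfold set_plus_def, blast)
  then have "(- v, - v \<bullet> xbar) \<in> ?K + ?E"
  proof (rule Farkas_closed_cone[OF _ assms(9) _ valid])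
    show "(0, 1) \<in> ?K + ?E" by (rule KE) (simp add: mem_epi_support)
    fix z assume z: "\<And>w s. (w, s) \<in> ?K + ?E \<Longrightarrow> w \<bullet> z \<le> s"
    have "z \<in> C"
      by (rule mem_closed_convex_by_inequalities[OF assms(3,2) z[OF KE[OF disjI2]]])
    moreover have "F y \<bullet> z \<le> F y \<bullet> y" if "y \<in> C" for y
      using that by (intro z[OF KE[OF disjI1[OF K]]]) auto
    ultimately have "z \<in> VI_sol F C" unfolding Minty by simp
    then show "- v \<bullet> z \<le> - v \<bullet> xbar"
      using v(2) by (auto simp: normal_cone_def inner_diff_right)
  qed
  then obtain d w s where d: "d \<in> ?K" and ws: "(w, s) \<in> ?E"
    and sum: "(- v, - v \<bullet> xbar) = d + (w, s)"
    unfolding set_plus_def by fast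
  obtain k :: nat and lam q where q: "\<forall>i\<in>{1..k}. 0 < lam i \<and> q i \<in> ?D"
    and dq: "d = (\<Sum>i=1..k. lam i *\<^sub>R q i)"
    by (rule convex_cone_hull_positive_combination[OF d])
  have "\<exists>y. y \<in> C \<and> fst (q i) = F y \<and> F y \<bullet> y \<le> snd (q i)" if "i \<in> {1..k}" for i
    using bspec[OF q that] by auto
  then obtain y where y: "\<And>i. i \<in> {1..k} \<Longrightarrow> y i \<in> C \<and> fst (q i) = F (y i) \<and> F (y i) \<bullet> y i \<le> snd (q i)"
    by metis
  have fst_d: "fst d = (\<Sum>i=1..k. lam i *\<^sub>R F (y i))"
    using y by (simp add: dq fst_sum)
  have snd_d: "snd d = (\<Sum>i=1..k. lam i * snd (q i))"
    by (simp add: dq snd_sum)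
  have v_eq: "- v = fst d + w" and v_val: "- v \<bullet> xbar = snd d + s"
    using sum by (metis fst_conv fst_add, metis snd_conv snd_add)
  \<comment> \<open>The slacks at \<open>xbar\<close> of all summands are nonnegative and add up to \<open>0\<close>, hence vanish.\<close>
  define slack where "slack i = lam i * (snd (q i) - F (y i) \<bullet> xbar)" for i
  have slack: "0 \<le> slack i" if "i \<in> {1..k}" for i
    using bspec[OF q that] y[OF that] xbar(2)[of "y i"] by (simp add: slack_def)
  have w: "w \<bullet> z \<le> s" if "z \<in> C" for z using ws that by (simp add: mem_epi_support)
  have "(\<Sum>i=1..k. slack i) + (s - w \<bullet> xbar) = 0"
    using v_val unfolding v_eq
    by (simp add: slack_def snd_d fst_d inner_add_left inner_sum_left right_diff_distrib sum_subtractf)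
  moreover have "0 \<le> (\<Sum>i=1..k. slack i)" using slack by (rule sum_nonneg)
  ultimately have "(\<Sum>i=1..k. slack i) = 0" and s: "s = w \<bullet> xbar"
    using w[OF xbar(1)] by linarith+
  then have slack0: "slack i = 0" if "i \<in> {1..k}" for i
    using that sum_nonneg_0[of "{1..k}" slack i] slack by blast
  have tight: "F (y i) \<bullet> (xbar - y i) = 0" if "i \<in> {1..k}" for i
    using slack0[OF that] bspec[OF q that] y[OF that] xbar(2)[of "y i"]
    by (auto simp: slack_def inner_diff_right)
  have "w \<in> normal_cone C xbar"
    using w s by (simp add: normal_cone_def inner_diff_right)
  with v(1) have "v + (\<Sum>i=1..k. lam i *\<^sub>R F (y i)) + w
      \<in> subdifferential f xbar + {\<Sum>i=1..k. lam i *\<^sub>R F (y i)} + normal_cone C xbar"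
    by (intro set_plus_intro singletonI)
  moreover have "v + (\<Sum>i=1..k. lam i *\<^sub>R F (y i)) + w = 0"
    using v_eq by (metis fst_d add.assoc add.right_inverse)
  ultimately have "0 \<in> subdifferential f xbar + {\<Sum>i=1..k. lam i *\<^sub>R F (y i)} + normal_cone C xbar"
    by simp
  moreover have "\<forall>i\<in>{1..k}. lam i > 0 \<and> y i \<in> C"
    using q y by blast
  ultimately show "\<exists>(k::nat) lam y. (\<forall>i\<in>{1..k}. lam i > 0 \<and> y i \<in> C) \<and>
       0 \<in> subdifferential f xbar + {\<Sum>i=1..k. lam i *\<^sub>R F (y i)} + normal_cone C xbar \<and>
       (\<forall>i\<in>{1..k}. F (y i) \<bullet> (xbar - y i) = 0)"
    using tight by blast
next
  assume "\<exists>(k::nat) lam y. (\<forall>i\<in>{1..k}. lam i > 0 \<and> y i \<in> C) \<and>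
       0 \<in> subdifferential f xbar + {\<Sum>i=1..k. lam i *\<^sub>R F (y i)} + normal_cone C xbar \<and>
       (\<forall>i\<in>{1..k}. F (y i) \<bullet> (xbar - y i) = 0)"
  then obtain k :: nat and lam y v w where
    pos: "\<And>i. i \<in> {1..k} \<Longrightarrow> 0 < lam i \<and> y i \<in> C"
    and v: "v \<in> subdifferential f xbar" and w: "w \<in> normal_cone C xbar"
    and zero: "0 = v + (\<Sum>i=1..k. lam i *\<^sub>R F (y i)) + w"
    and tight: "\<And>i. i \<in> {1..k} \<Longrightarrow> F (y i) \<bullet> (xbar - y i) = 0"
    unfolding set_plus_def by blast
  have "f xbar \<le> f z" if "z \<in> VI_sol F C" for z
  proof -
    have z: "z \<in> C" "\<And>y. y \<in> C \<Longrightarrow> F y \<bullet> z \<le> F y \<bullet> y"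
      using that unfolding VI_sol_eq_Minty[OF assms(3,4,5)] by auto
    have "lam i * (F (y i) \<bullet> (z - xbar)) \<le> 0" if "i \<in> {1..k}" for i
      using pos[OF that] z(2)[of "y i"] tight[OF that]
      by (intro mult_nonneg_nonpos) (auto simp: inner_diff_right)
    then have "(\<Sum>i=1..k. lam i *\<^sub>R F (y i)) \<bullet> (z - xbar) \<le> 0"
      unfolding inner_sum_left inner_scaleR_left by (rule sum_nonpos)
    moreover have "w \<bullet> (z - xbar) \<le> 0" using w z(1) by (simp add: normal_cone_def)
    moreover have "v \<bullet> (z - xbar) + (\<Sum>i=1..k. lam i *\<^sub>R F (y i)) \<bullet> (z - xbar) + w \<bullet> (z - xbar) = 0"
      using zero by (metis inner_add_left inner_zero_left)
    moreover have "f xbar + v \<bullet> (z - xbar) \<le> f z" using v by (simp add: subdifferential_def)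
    ultimately show ?thesis by linarith
  qed
  then show "SMPEC_solution f F C xbar" using assms(8) by (simp add: SMPEC_solution_def)
qed

end
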